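(* For all integers $n\ge 1$ and $0\le l<n$, the bivariate Laurent polynomial $$a_n^l(z_1,z_2)=\sum_{i=0}^{l}\tilde a_{n-i}(z_1,z_2)\,b_n^i(z_1,z_2)$$ (with $\tilde a_m$ and $b_n^i$ as defined in the context) is symmetric, generates polynomials up to degree $2n-1$, and reproduces polynomials up to degree $2l+1$. Moreover, for every $n\ge1$ the symbol $a_n^{n-1}$ (the case $l=n-1$) is interpolatory.
   Context: A symbol is a bivariate Laurent polynomial $a(z_1,z_2)=\sum_{\alpha\in\mathbb Z^2}a_\alpha z_1^{\alpha_1}z_2^{\alpha_2}$ with finitely many nonzero real coefficients $a_\alpha$, regarded as a function of $(z_1,z_2)\in(\mathbb C\setminus\{0\})^2$. For $k=(k_1,k_2)\in\mathbb N_0^2$, $D^k=\partial_{z_1}^{k_1}\partial_{z_2}^{k_2}$ and $|k|=k_1+k_2$. Let $E'=\{(-1,1),(1,-1),(-1,-1)\}$. Symmetric: $a(z_1,z_2)=a(1/z_1,z_2)=a(z_1,1/z_2)=a(z_2,z_1)$. Generates polynomials up to degree $m$: $(D^k a)(z)=0$ for all $z\in E'$ and all $k\in\mathbb N_0^2$ with $0\le|k|\le m$. Reproduces polynomials up to degree $m'$ (for a symbol that generates polynomials up to some degree $m\ge m'$): $a(1,1)=4$ and $(D^k a)(1,1)=0$ for all $k\in\mathbb N_0^2$ with $0<|k|\le m'$. Interpolatory: $a(z_1,z_2)+a(z_1,-z_2)+a(-z_1,z_2)+a(-z_1,-z_2)=4$ (equivalently $a_{(0,0)}=1$ and $a_{2\alpha}=0$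 for $\alpha\in\mathbb Z^2\setminus\{(0,0)\}$). Definition of the family. Let $$\sigma(z)=\frac{(1+z)^2}{4z},\qquad \delta(z)=-\frac{(1-z)^2}{4z},$$ $$S(z_1,z_2)=\sigma(z_1)\sigma(z_2),\qquad G(z_1,z_2)=\sigma(z_1)\sigma(z_2)-\delta(z_1)\delta(z_2).$$ For $m\ge1$ let $\tilde a_m=4\,S^{\lceil m/2\rceil}G^{\lfloor m/2\rfloor}$. For $0\le j\le i<n$ let $$c_n^{(i,j)}=\sum_{k=0}^{\lfloor i/2\rfloor}\binom{\lfloor\frac{n-i}{2}\rfloor+k-1}{k}\binom{n+i-2j-1}{i-j-k}\binom{n+2j-i-1}{j-k},$$ where a binomial coefficient $\binom{p}{q}$ is $0$ if $q<0$, $\binom{p}{0}=1$ for every integer $p\ge-1$ (in particular $\binom{-1}{0}=1$), and $\binom{p}{q}=0$ if $0\le p<q$. Finally $$b_n^i(z_1,z_2)=\sum_{j=0}^{i}c_n^{(i,j)}\bigl(\sigma(z_1)\delta(z_1)\bigr)^{i-j}\bigl(\sigma(z_2)\delta(z_2)\bigr)^{j}.$$ *)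

theory Defs
  imports "HOL-Analysis.Analysis"
begin

text \<open>
  Symbols are functions of two complex variables. Only their values at nonzero arguments
  matter: every identity below is restricted to nonzero arguments, and derivatives are
  taken only at points whose coordinates are $1$ or $-1$.
\<close>

definition laurent_symbol :: "(complex \<Rightarrow> complex \<Rightarrow> complex) \<Rightarrow> bool" where
  "laurent_symbol a \<longleftrightarrow>
     (\<exists>c :: int \<times> int \<Rightarrow> real. finite {\<alpha>. c \<alpha> \<noteq> 0} \<and>
        (\<forall>z1 z2. z1 \<noteq> 0 \<longrightarrow> z2 \<noteq> 0 \<longrightarrow>
           a z1 z2 = (\<Sum>\<alpha> | c \<alpha> \<noteq> 0. of_real (c \<alpha>) * z1 powi (fst \<alpha>) * z2 powi (snd \<alpha>))))"

definition partial_D ::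
  "nat \<Rightarrow> nat \<Rightarrow> (complex \<Rightarrow> complex \<Rightarrow> complex) \<Rightarrow> complex \<Rightarrow> complex \<Rightarrow> complex" where
  "partial_D k1 k2 a z1 z2 = (deriv ^^ k1) (\<lambda>w1. (deriv ^^ k2) (\<lambda>w2. a w1 w2) z2) z1"

definition symbol_symmetric :: "(complex \<Rightarrow> complex \<Rightarrow> complex) \<Rightarrow> bool" where
  "symbol_symmetric a \<longleftrightarrow>
     (\<forall>z1 z2. z1 \<noteq> 0 \<longrightarrow> z2 \<noteq> 0 \<longrightarrow>
        a z1 z2 = a (1 / z1) z2 \<and> a z1 z2 = a z1 (1 / z2) \<and> a z1 z2 = a z2 z1)"

definition generates_polys :: "(complex \<Rightarrow> complex \<Rightarrow> complex) \<Rightarrow> nat \<Rightarrow> bool" where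
  "generates_polys a m \<longleftrightarrow>
     (\<forall>(z1, z2) \<in> {(-1, 1), (1, -1), (-1, -1)}.
        \<forall>k1 k2. k1 + k2 \<le> m \<longrightarrow> partial_D k1 k2 a z1 z2 = 0)"

definition reproduces_polys :: "(complex \<Rightarrow> complex \<Rightarrow> complex) \<Rightarrow> nat \<Rightarrow> bool" where
  "reproduces_polys a m' \<longleftrightarrow>
     (\<exists>m \<ge> m'. generates_polys a m) \<and> a 1 1 = 4 \<and>
     (\<forall>k1 k2. 0 < k1 + k2 \<and> k1 + k2 \<le> m' \<longrightarrow> partial_D k1 k2 a 1 1 = 0)"

definition interpolatory :: "(complex \<Rightarrow> complex \<Rightarrow> complex) \<Rightarrow> bool" where
  "interpolatory a \<longleftrightarrow>
     (\<forall>z1 z2. z1 \<noteq> 0 \<longrightarrow> z2 \<noteq> 0 \<longrightarrow>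
        a z1 z2 + a z1 (- z2) + a (- z1) z2 + a (- z1) (- z2) = 4)"

definition sigma_fun :: "complex \<Rightarrow> complex" where
  "sigma_fun z = (1 + z)\<^sup>2 / (4 * z)"

definition delta_fun :: "complex \<Rightarrow> complex" where
  "delta_fun z = - ((1 - z)\<^sup>2 / (4 * z))"

definition S_fun :: "complex \<Rightarrow> complex \<Rightarrow> complex" where
  "S_fun z1 z2 = sigma_fun z1 * sigma_fun z2"

definition G_fun :: "complex \<Rightarrow> complex \<Rightarrow> complex" where
  "G_fun z1 z2 = sigma_fun z1 * sigma_fun z2 - delta_fun z1 * delta_fun z2"

definition a_tilde :: "nat \<Rightarrow> complex \<Rightarrow> complex \<Rightarrow> complex" where
  "a_tilde m z1 z2 =
     4 * S_fun z1 z2 ^ nat \<lceil>real m / 2\<rceil> * G_fun z1 z2 ^ nat \<lfloor>real m / 2\<rfloor>"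

text \<open>
  In \<open>coeff_c\<close> with \<open>j \<le> i < n\<close> the upper argument is never below $-1$,
  and it equals $-1$ only when the lower argument is $0$, where the value is $1$.
\<close>

definition int_binom :: "int \<Rightarrow> int \<Rightarrow> real" where
  "int_binom p q = (if q < 0 then 0 else real_of_int p gchoose nat q)"

definition coeff_c :: "nat \<Rightarrow> nat \<Rightarrow> nat \<Rightarrow> real" where
  "coeff_c n i j =
     (\<Sum>k = 0..i div 2.
        int_binom ((int n - int i) div 2 + int k - 1) (int k) *
        int_binom (int n + int i - 2 * int j - 1) (int i - int j - int k) *
        int_binom (int n + 2 * int j - int i - 1) (int j - int k))"

definition b_fun :: "nat \<Rightarrow> nat \<Rightarrow> complex \<Rightarrow> complex \<Rightarrow> complex" where
  "b_fun n i z1 z2 =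
     (\<Sum>j = 0..i. of_real (coeff_c n i j) *
        (sigma_fun z1 * delta_fun z1) ^ (i - j) * (sigma_fun z2 * delta_fun z2) ^ j)"

definition a_family :: "nat \<Rightarrow> nat \<Rightarrow> complex \<Rightarrow> complex \<Rightarrow> complex" where
  "a_family n l z1 z2 = (\<Sum>i = 0..l. a_tilde (n - i) z1 z2 * b_fun n i z1 z2)"

end

theory Submission
  imports Defs "HOL-Complex_Analysis.Complex_Singularities"
begin

text \<open>
  Write $x = \sigma(z_1)$, $p = \delta(z_1) = 1 - x$, $y = \sigma(z_2)$, $q = \delta(z_2) = 1 - y$
  and $m = n - 1$. Since $G + pq = S$, the binomial theorem collapses the inner sums of the case
  $l = m$: the symbol $a_n^{n-1} / 4$ is the sum over $a + b \le m$ of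
  $\binom{m+a-b}{a} \binom{m+b-a}{b} p^a x^{m-b} q^b y^{m-a}$, weighted by $xy - pq$ if $a + b < m$
  and by $xy$ if $a + b = m$.

  These terms are probabilities. Let $X_A$ be a simple random walk after $A$ steps with up-probability
  $p$, and $Y_B$ an independent one after $B$ steps with up-probability $q$. The term $(a, b)$ belongs
  to the event $X_A = Y_{2m-A} = a + b - m$ with $A = m + a - b$. The probability that
  $|X_A| > |Y_{2m+1-A}|$ rises from $0$ at $A = 0$ to $1$ at $A = 2m + 1$, and its increments only
  come from the event $|X_A| = |Y_{2m-A}|$. Summing the increments gives exactly the sum of the
  four sign changes of the symbol, because $z \mapsto -z$ exchanges $\sigma$ and $\delta$. Hence the
  symbol is interpolatory.

  Generation follows by counting orders of vanishing factor by factor. At $(1, 1)$, interpolation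
  writes $a_n^{n-1} - 4$ through values of the symbol near the other three corners, where it vanishes
  to order $2n$; the terms with $i > l$ vanish to order $2l + 2$, which gives reproduction for all $l$.
\<close>

section \<open>Crossings of two random walks\<close>

text \<open>The expectation of \<open>f\<close> at the position of a walk after \<open>A\<close>
  steps, of which \<alpha> go up with weight \<open>p\<close> and the others down with weight
  \<open>x\<close>. In a commutative ring these weights are formal; \<open>p + x = 1\<close> is
  assumed only where the total mass enters.\<close>

definition walk_mean :: "'a::comm_ring_1 \<Rightarrow> 'a \<Rightarrow> nat \<Rightarrow> (int \<Rightarrow> 'a) \<Rightarrow> 'a" where
  "walk_mean p x A f =
     (\<Sum>\<alpha>\<le>A. of_nat (A choose \<alpha>) * p ^ \<alpha> * x ^ (A - \<alpha>) * f (2 * int \<alpha> - int A))"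

lemma walk_mean_0 [simp]: "walk_mean p x 0 f = f 0"
  by (simp add: walk_mean_def)

lemma walk_mean_add:
  "walk_mean p x A (\<lambda>X. f X + g X) = walk_mean p x A f + walk_mean p x A g"
  by (simp add: walk_mean_def distrib_left sum.distrib)

lemma walk_mean_diff:
  "walk_mean p x A (\<lambda>X. f X - g X) = walk_mean p x A f - walk_mean p x A g"
  by (simp add: walk_mean_def right_diff_distrib sum_subtractf)

lemma walk_mean_scale:
  "walk_mean p x A (\<lambda>X. c * f X) = c * walk_mean p x A f"
  by (simp add: walk_mean_def sum_distrib_left mult_ac)

text \<open>The parity condition is the point of this rule: it later rules out pairs of positions of
  different parity, and the origin after an odd number of steps.\<close>

lemma walk_mean_cong:
  assumes "\<And>X. even (X - int A) \<Longrightarrow> \<bar>X\<bar> \<le> int A \<Longrightarrow> f X = g X"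
  shows "walk_mean p x A f = walk_mean p x A g"
  unfolding walk_mean_def
proof (rule sum.cong)
  fix \<alpha> assume "\<alpha> \<in> {..A}"
  then have "f (2 * int \<alpha> - int A) = g (2 * int \<alpha> - int A)"
    by (intro assms) auto
  then show "of_nat (A choose \<alpha>) * p ^ \<alpha> * x ^ (A - \<alpha>) * f (2 * int \<alpha> - int A) =
      of_nat (A choose \<alpha>) * p ^ \<alpha> * x ^ (A - \<alpha>) * g (2 * int \<alpha> - int A)"
    by simp
qed simp

text \<open>Up-steps and down-steps trade places, \<alpha> becoming \<open>A - \<alpha>\<close>.
  This produces the kernels of the other three sign changes.\<close>

lemma walk_mean_reflect:
  "walk_mean p x A (\<lambda>X. f (- X)) = walk_mean x p A f"
  unfolding walk_mean_def
proof (rule sum.reindex_bij_witness[of _ "\<lambda>\<alpha>. A - \<alpha>" "\<lambda>\<alpha>. A - \<alpha>"])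
  fix \<alpha> assume "\<alpha> \<in> {..A}"
  then show "of_nat (A choose (A - \<alpha>)) * x ^ (A - \<alpha>) * p ^ (A - (A - \<alpha>)) * f (2 * int (A - \<alpha>) - int A)
      = of_nat (A choose \<alpha>) * p ^ \<alpha> * x ^ (A - \<alpha>) * f (- (2 * int \<alpha> - int A))"
    by (simp add: binomial_symmetric[symmetric] of_nat_diff mult_ac)
qed auto

lemma walk_mean_const:
  assumes "p + x = 1"
  shows "walk_mean p x A (\<lambda>_. c) = c"
  using binomial_ring[of p x A] assms
  by (simp add: walk_mean_def flip: sum_distrib_right)

text \<open>Conditioning on a single step, which amounts to Pascal's rule for
  \<open>Suc A choose Suc \<alpha>\<close>.\<close>

lemma walk_mean_Suc:
  "walk_mean p x (Suc A) f = walk_mean p x A (\<lambda>X. p * f (X + 1) + x * f (X - 1))"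
proof -
  let ?g = "\<lambda>\<alpha>. f (2 * int \<alpha> - int (Suc A))"
  let ?t = "\<lambda>k \<alpha>. of_nat k * p ^ \<alpha> * x ^ (Suc A - \<alpha>) * ?g \<alpha>"
  have "walk_mean p x (Suc A) f = ?t 1 0 + (\<Sum>\<alpha>\<le>A. ?t (Suc A choose Suc \<alpha>) (Suc \<alpha>))"
    unfolding walk_mean_def by (subst sum.atMost_Suc_shift) simp
  also have "(\<Sum>\<alpha>\<le>A. ?t (Suc A choose Suc \<alpha>) (Suc \<alpha>)) =
      (\<Sum>\<alpha>\<le>A. ?t (A choose \<alpha>) (Suc \<alpha>)) + (\<Sum>\<alpha>\<le>A. ?t (A choose Suc \<alpha>) (Suc \<alpha>))"
    by (simp add: sum.distrib[symmetric] algebra_simps)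
  also have "?t 1 0 + ((\<Sum>\<alpha>\<le>A. ?t (A choose \<alpha>) (Suc \<alpha>)) + (\<Sum>\<alpha>\<le>A. ?t (A choose Suc \<alpha>) (Suc \<alpha>)))
     = (\<Sum>\<alpha>\<le>A. ?t (A choose \<alpha>) (Suc \<alpha>)) + (\<Sum>\<alpha>\<le>Suc A. ?t (A choose \<alpha>) \<alpha>)"
    by (subst sum.atMost_Suc_shift) (simp add: binomial_eq_0)
  also have "(\<Sum>\<alpha>\<le>Suc A. ?t (A choose \<alpha>) \<alpha>) = (\<Sum>\<alpha>\<le>A. ?t (A choose \<alpha>) \<alpha>)"
    by (simp add: binomial_eq_0)
  also have "\<dots> = walk_mean p x A (\<lambda>X. x * f (X - 1))"
    unfolding walk_mean_def
    by (rule sum.cong) (auto simp: Suc_diff_le algebra_simps)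
  also have "(\<Sum>\<alpha>\<le>A. ?t (A choose \<alpha>) (Suc \<alpha>)) = walk_mean p x A (\<lambda>X. p * f (X + 1))"
    unfolding walk_mean_def
    by (rule sum.cong) (auto simp: algebra_simps)
  finally show ?thesis by (simp add: walk_mean_add)
qed

text \<open>Let \<open>\<Phi> A\<close> be the mean of \<phi> after \<open>A\<close> steps of the
  first walk and \<open>Suc N - A\<close> of the second. The means \<open>\<Phi> A\<close> and
  \<open>\<Phi> (Suc A)\<close> share \<open>A\<close> and \<open>N - A\<close> steps and differ
  only in which walk makes the remaining one, so summand \<open>A\<close> is
  \<open>\<Phi> (Suc A) - \<Phi> A\<close>.\<close>

lemma walk_pair_telescope:
  fixes \<phi> :: "int \<Rightarrow> int \<Rightarrow> 'a::comm_ring_1"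
  shows "(\<Sum>A\<le>N. walk_mean p x A (\<lambda>X. walk_mean q y (N - A) (\<lambda>Y.
           p * \<phi> (X + 1) Y + x * \<phi> (X - 1) Y - (q * \<phi> X (Y + 1) + y * \<phi> X (Y - 1)))))
         = walk_mean p x (Suc N) (\<lambda>X. \<phi> X 0) - walk_mean q y (Suc N) (\<phi> 0)"
proof -
  define \<Phi> where "\<Phi> A = walk_mean p x A (\<lambda>X. walk_mean q y (Suc N - A) (\<phi> X))" for A
  have "walk_mean p x A (\<lambda>X. walk_mean q y (N - A) (\<lambda>Y.
           p * \<phi> (X + 1) Y + x * \<phi> (X - 1) Y - (q * \<phi> X (Y + 1) + y * \<phi> X (Y - 1))))
         = \<Phi> (Suc A) - \<Phi> A" if "A \<le> N" for A
  proof -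
    have "\<Phi> A = walk_mean p x A (\<lambda>X. walk_mean q y (N - A) (\<lambda>Y. q * \<phi> X (Y + 1) + y * \<phi> X (Y - 1)))"
      using that by (simp add: \<Phi>_def Suc_diff_le walk_mean_Suc)
    moreover have "\<Phi> (Suc A) = walk_mean p x A (\<lambda>X. walk_mean q y (N - A) (\<lambda>Y. p * \<phi> (X + 1) Y + x * \<phi> (X - 1) Y))"
      by (simp add: \<Phi>_def walk_mean_Suc walk_mean_add walk_mean_scale)
    ultimately show ?thesis by (simp add: walk_mean_diff)
  qed
  then have "(\<Sum>A\<le>N. walk_mean p x A (\<lambda>X. walk_mean q y (N - A) (\<lambda>Y.
           p * \<phi> (X + 1) Y + x * \<phi> (X - 1) Y - (q * \<phi> X (Y + 1) + y * \<phi> X (Y - 1)))))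
        = (\<Sum>A<Suc N. \<Phi> (Suc A) - \<Phi> A)"
    by (simp add: lessThan_Suc_atMost)
  also have "\<dots> = \<Phi> (Suc N) - \<Phi> 0" by (rule sum_lessThan_telescope)
  finally show ?thesis by (simp add: \<Phi>_def)
qed

text \<open>
  The part of the crossing weight seen by one of the four sign changes of the symbol. At the origin,
  where both walks meet all four diagonal rays, the total weight $1 = (p + x)(q + y)$ is shared out.
\<close>

definition diag_weight :: "'a::zero \<Rightarrow> 'a \<Rightarrow> int \<Rightarrow> int \<Rightarrow> 'a" where
  "diag_weight w\<^sub>0 w X Y = (if X = Y \<and> X < 0 then w else if X = 0 \<and> Y = 0 then w\<^sub>0 else 0)"

text \<open>Here \<open>a\<close> and \<open>b\<close> count the up-steps of walks of lengths
  \<open>m + a - b\<close> and \<open>m + b - a\<close>, so \<open>m - b\<close> and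
  \<open>m - a\<close> count the down-steps. No subtraction truncates, since
  \<open>a + b \<le> m\<close>.\<close>

definition diag_kernel :: "nat \<Rightarrow> 'a::comm_ring_1 \<Rightarrow> 'a \<Rightarrow> 'a \<Rightarrow> 'a \<Rightarrow> 'a" where
  "diag_kernel m p x q y =
     (\<Sum>(a, b) | a + b \<le> m. of_nat ((m + a - b) choose a) * of_nat ((m + b - a) choose b) *
        (p ^ a * x ^ (m - b)) * (q ^ b * y ^ (m - a)) *
        (if a + b = m then x * y else x * y - p * q))"

lemma diag_kernel_eq_walk_means:
  "diag_kernel m p x q y =
     (\<Sum>A\<le>2 * m. walk_mean p x A (\<lambda>X. walk_mean q y (2 * m - A) (\<lambda>Y.
        diag_weight (x * y) (x * y - p * q) X Y)))"
proof -
  let ?w = "diag_weight (x * y) (x * y - p * q)"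
  let ?T = "SIGMA A : {..2 * m}. SIGMA \<alpha> : {..A}. {..2 * m - A}"
  define t where "t A \<alpha> \<beta> = of_nat (A choose \<alpha>) * p ^ \<alpha> * x ^ (A - \<alpha>) *
     (of_nat ((2 * m - A) choose \<beta>) * q ^ \<beta> * y ^ (2 * m - A - \<beta>) *
        ?w (2 * int \<alpha> - int A) (2 * int \<beta> - int (2 * m - A)))" for A \<alpha> \<beta>
  \<comment> \<open>Equal positions mean \<open>A + \<beta> = \<alpha> + m\<close>; the common
    position is then \<open>\<alpha> + \<beta> - m\<close>, which the weight requires not to be
    positive.\<close>
  let ?D = "{(A, \<alpha>, \<beta>). A + \<beta> = \<alpha> + m \<and> \<alpha> + \<beta> \<le> m}"
  have fin: "finite ?T" by auto
  have "(\<Sum>A\<le>2 * m. walk_mean p x A (\<lambda>X. walk_mean q y (2 * m - A) (?w X)))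
      = (\<Sum>A\<le>2 * m. \<Sum>\<alpha>\<le>A. \<Sum>\<beta>\<le>2 * m - A. t A \<alpha> \<beta>)"
    by (simp add: walk_mean_def t_def sum_distrib_left)
  also have "\<dots> = (\<Sum>(A, \<alpha>, \<beta>)\<in>?T. t A \<alpha> \<beta>)"
    by (simp add: sum.Sigma)
  also have "\<dots> = (\<Sum>(A, \<alpha>, \<beta>)\<in>?D. t A \<alpha> \<beta>)"
  proof (rule sum.mono_neutral_right[OF fin])
    show "?D \<subseteq> ?T" by auto
    show "\<forall>i\<in>?T - ?D. (case i of (A, \<alpha>, \<beta>) \<Rightarrow> t A \<alpha> \<beta>) = 0"
      by (auto simp: t_def diag_weight_def of_nat_diff split: if_splits)
  qed
  also have "\<dots> = diag_kernel m p x q y"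
    unfolding diag_kernel_def
  proof (rule sum.reindex_bij_witness[of _ "\<lambda>(a, b). (m + a - b, a, b)" "\<lambda>(A, \<alpha>, \<beta>). (\<alpha>, \<beta>)"], goal_cases)
    case (5 s)
    obtain A a b where s: "s = (A, a, b)" by (cases s)
    with 5 have ab: "a + b \<le> m" and A: "A = m + a - b" by auto
    have e: "2 * m - A = m + b - a" "A - a = m - b" "m + b - a - b = m - a"
      using ab A by auto
    have "2 * int a - int A = int a + int b - int m" "2 * int b - int (m + b - a) = int a + int b - int m"
      using ab A by (auto simp: of_nat_diff)
    then have w: "?w (2 * int a - int A) (2 * int b - int (2 * m - A)) = (if a + b = m then x * y else x * y - p * q)"
      using ab by (auto simp: diag_weight_def e)
    show ?case unfolding s prod.case t_def w unfolding e by (simp only: A mult_ac)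
  qed auto
  finally show ?thesis by simp
qed

text \<open>Off the diagonals, parity keeps \<open>\<bar>X\<bar>\<close> and
  \<open>\<bar>Y\<bar>\<close> at least 2 apart, so no single step changes their order and both
  sides are 0. On a diagonal away from the origin the left side is a difference such as
  \<open>x - q\<close> for \<open>X = Y < 0\<close>, which equals \<open>x * y - p * q\<close>
  because both walks have total weight 1. At the origin it is 1, the sum of the four
  products.\<close>

lemma walk_crossing_weight:
  fixes p x q y :: "'a::comm_ring_1"
  assumes px: "p + x = 1" and qy: "q + y = 1" and even: "even (X - Y)"
  defines "\<phi> \<equiv> \<lambda>X Y :: int. if \<bar>Y\<bar> < \<bar>X\<bar> then 1 else 0 :: 'a"
  shows "p * \<phi> (X + 1) Y + x * \<phi> (X - 1) Y - (q * \<phi> X (Y + 1) + y * \<phi> X (Y - 1)) =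
     diag_weight (x * y) (x * y - p * q) X Y + diag_weight (p * y) (p * y - x * q) (- X) Y +
     (diag_weight (x * q) (x * q - p * y) X (- Y) + diag_weight (p * q) (p * q - x * y) (- X) (- Y))"
proof -
  have p: "p = 1 - x" and q: "q = 1 - y"
    using px qy by (simp_all add: eq_diff_eq)
  consider "\<bar>X\<bar> = \<bar>Y\<bar>" | "\<bar>X\<bar> + 2 \<le> \<bar>Y\<bar>" | "\<bar>Y\<bar> + 2 \<le> \<bar>X\<bar>"
  proof -
    have "even (\<bar>X\<bar> - \<bar>Y\<bar>)" using even by (auto simp: abs_if)
    then obtain k where "\<bar>X\<bar> - \<bar>Y\<bar> = 2 * k" ..
    with that show thesis by (cases k "0::int" rule: linorder_cases) auto
  qed
  then show ?thesis
  proof cases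
    case 1
    consider "X = 0 \<and> Y = 0" | "X = Y \<and> X > 0" | "X = Y \<and> X < 0" | "X = - Y \<and> X > 0" | "X = - Y \<and> X < 0"
      using 1 by linarith
    then show ?thesis
      by cases (auto simp: \<phi>_def diag_weight_def p q algebra_simps)
  next
    case 2
    then show ?thesis by (auto simp: \<phi>_def diag_weight_def)
  next
    case 3
    then show ?thesis by (auto simp: \<phi>_def diag_weight_def px qy)
  qed
qed

theorem diag_kernel_partition_of_unity:
  fixes p x q y :: "'a::comm_ring_1"
  assumes px: "p + x = 1" and qy: "q + y = 1"
  shows "diag_kernel m p x q y + diag_kernel m x p q y + (diag_kernel m p x y q + diag_kernel m x p y q) = 1"
proof -
  define \<phi> :: "int \<Rightarrow> int \<Rightarrow> 'a" where "\<phi> = (\<lambda>X Y. if \<bar>Y\<bar> < \<bar>X\<bar> then 1 else 0)"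
  let ?E = "\<lambda>f. \<Sum>A\<le>2 * m. walk_mean p x A (\<lambda>X. walk_mean q y (2 * m - A) (f X))"
  let ?w1 = "diag_weight (x * y) (x * y - p * q)"
  let ?w2 = "diag_weight (p * y) (p * y - x * q)"
  let ?w3 = "diag_weight (x * q) (x * q - p * y)"
  let ?w4 = "diag_weight (p * q) (p * q - x * y)"
  have "?E (\<lambda>X Y. p * \<phi> (X + 1) Y + x * \<phi> (X - 1) Y - (q * \<phi> X (Y + 1) + y * \<phi> X (Y - 1)))
     = ?E (\<lambda>X Y. ?w1 X Y + ?w2 (- X) Y + (?w3 X (- Y) + ?w4 (- X) (- Y)))"
  proof (intro sum.cong refl walk_mean_cong, goal_cases)
    case (1 A X Y)
    \<comment> \<open>The step numbers \<open>A\<close> and \<open>2 * m - A\<close> have the same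
      parity, hence so do the positions.\<close>
    have "even (X - Y)" using 1 by (auto simp: of_nat_diff)
    then show ?case
      using walk_crossing_weight[OF px qy] by (simp add: \<phi>_def)
  qed
  also have "\<dots> = ?E ?w1 + ?E (\<lambda>X. ?w2 (- X)) + (?E (\<lambda>X Y. ?w3 X (- Y)) + ?E (\<lambda>X Y. ?w4 (- X) (- Y)))"
    by (simp add: walk_mean_add sum.distrib)
  also have "?E ?w1 = diag_kernel m p x q y"
    by (simp add: diag_kernel_eq_walk_means)
  also have "?E (\<lambda>X. ?w2 (- X)) = diag_kernel m x p q y"
    unfolding diag_kernel_eq_walk_means
    by (subst walk_mean_reflect[where f = "\<lambda>X. walk_mean _ _ _ (?w2 X)"]) simp
  also have "?E (\<lambda>X Y. ?w3 X (- Y)) = diag_kernel m p x y q"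
    unfolding diag_kernel_eq_walk_means by (simp add: walk_mean_reflect)
  also have "?E (\<lambda>X Y. ?w4 (- X) (- Y)) = diag_kernel m x p y q"
    unfolding diag_kernel_eq_walk_means
    by (subst walk_mean_reflect[where f = "\<lambda>X. walk_mean _ _ _ (\<lambda>Y. ?w4 X (- Y))"])
       (simp add: walk_mean_reflect)
  finally have "?E (\<lambda>X Y. p * \<phi> (X + 1) Y + x * \<phi> (X - 1) Y - (q * \<phi> X (Y + 1) + y * \<phi> X (Y - 1))) =
    diag_kernel m p x q y + diag_kernel m x p q y + (diag_kernel m p x y q + diag_kernel m x p y q)" .
  \<comment> \<open>After an odd number of steps a walk is never at 0, so the indicator is
    constantly 1 at this end of the telescope and constantly 0 at the other.\<close>
  moreover have "walk_mean p x (Suc (2 * m)) (\<lambda>X. \<phi> X 0) = walk_mean p x (Suc (2 * m)) (\<lambda>X. 1)"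
    by (rule walk_mean_cong) (auto simp: \<phi>_def)
  moreover have "walk_mean q y (Suc (2 * m)) (\<phi> 0) = walk_mean q y (Suc (2 * m)) (\<lambda>X. 0)"
    by (rule walk_mean_cong) (auto simp: \<phi>_def)
  ultimately show ?thesis
    using walk_pair_telescope[of p x q y "2 * m" \<phi>] px qy by (simp add: walk_mean_const)
qed

section \<open>The interpolatory symbols\<close>

lemma nat_ceiling_half: "nat \<lceil>real m / 2\<rceil> = (m + 1) div 2"
proof -
  have "\<lceil>real m / 2\<rceil> = int ((m + 1) div 2)"
    by (cases "even m") (auto simp: ceiling_eq_iff elim!: evenE oddE)
  then show ?thesis by simp
qed

lemma nat_floor_half: "nat \<lfloor>real m / 2\<rfloor> = m div 2"
proof -
  have "\<lfloor>real m / 2\<rfloor> = int (m div 2)"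
    by (cases "even m") (auto simp: floor_eq_iff elim!: evenE oddE)
  then show ?thesis by simp
qed

lemma a_tilde_eq:
  "a_tilde m z1 z2 = 4 * S_fun z1 z2 ^ ((m + 1) div 2) * G_fun z1 z2 ^ (m div 2)"
  by (simp add: a_tilde_def nat_ceiling_half nat_floor_half)

lemma int_binom_of_nat: "int_binom (int p) (int q) = of_nat (p choose q)"
  by (simp add: int_binom_def binomial_gbinomial)

text \<open>The upper argument is negative only for \<open>M = k = 0\<close>; there the truncated
  subtraction gives \<open>0 choose 0 = 1\<close>, the value prescribed for -1 over 0.\<close>

lemma int_binom_pred:
  "int_binom (int M + int k - 1) (int k) = of_nat ((M + k - 1) choose k)"
proof (cases "M + k = 0")
  case False
  then have "int M + int k - 1 = int (M + k - 1)" by linarith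
  then show ?thesis by (simp only: int_binom_of_nat)
qed (simp add: int_binom_def)

lemma coeff_c_eq:
  assumes "a + b \<le> m"
  shows "coeff_c (Suc m) (a + b) b =
     (\<Sum>k\<le>min a b. of_nat (((m + 1 - (a + b)) div 2 + k - 1) choose k) *
        (of_nat ((m + a - b) choose (a - k)) * of_nat ((m + b - a) choose (b - k))))"
proof -
  have e: "(int (Suc m) - int (a + b)) div 2 = int ((m + 1 - (a + b)) div 2)"
    "int (Suc m) + int (a + b) - 2 * int b - 1 = int (m + a - b)"
    "int (Suc m) + 2 * int b - int (a + b) - 1 = int (m + b - a)"
    "int (a + b) - int b - int k = int a - int k" for k
    using assms by (auto simp: of_nat_diff zdiv_int)
  have "coeff_c (Suc m) (a + b) b =
     (\<Sum>k = 0..(a + b) div 2. of_nat (((m + 1 - (a + b)) div 2 + k - 1) choose k) *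
        int_binom (int (m + a - b)) (int a - int k) * int_binom (int (m + b - a)) (int b - int k))"
    unfolding coeff_c_def e int_binom_pred ..
  \<comment> \<open>Beyond \<open>min a b\<close> one of the lower arguments is negative, and the
    binomial coefficient is 0 by convention.\<close>
  also have "\<dots> = (\<Sum>k\<le>min a b. of_nat (((m + 1 - (a + b)) div 2 + k - 1) choose k) *
        int_binom (int (m + a - b)) (int a - int k) * int_binom (int (m + b - a)) (int b - int k))"
    by (rule sum.mono_neutral_right) (auto simp: int_binom_def)
  also have "\<dots> = (\<Sum>k\<le>min a b. of_nat (((m + 1 - (a + b)) div 2 + k - 1) choose k) *
        (of_nat ((m + a - b) choose (a - k)) * of_nat ((m + b - a) choose (b - k))))"
    by (rule sum.cong) (auto simp: int_binom_of_nat mult.assoc simp flip: of_nat_diff)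
  finally show ?thesis .
qed

text \<open>With \<open>N = (r + 1) div 2 - 1\<close> the sum is the binomial expansion of
  \<open>(D + G) ^ N = S ^ N\<close>, times the common factor of powers of \<open>S\<close> and one
  spare \<open>G\<close>. For even \<open>r\<close> the range has one index more than the expansion,
  where the binomial coefficient is 0.\<close>

lemma binomial_collapse:
  fixes S G D :: "'a::comm_ring_1"
  assumes "G + D = S" and r: "r > 0"
  shows "(\<Sum>k\<le>r div 2. of_nat (((r + 1) div 2 - 1) choose k) * D ^ k *
            S ^ (r + 1 - (r + 1) div 2) * G ^ ((r + 1) div 2 - k)) = S ^ r * G"
proof -
  define N where "N = (r + 1) div 2 - 1"
  have N: "(r + 1) div 2 = Suc N" "r + 1 - (r + 1) div 2 + N = r" "N \<le> r div 2"
    using r by (auto simp: N_def)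
  have "(\<Sum>k\<le>r div 2. of_nat (N choose k) * D ^ k * S ^ (r + 1 - Suc N) * G ^ (Suc N - k))
      = (\<Sum>k\<le>N. of_nat (N choose k) * D ^ k * S ^ (r + 1 - Suc N) * G ^ (Suc N - k))"
    using N by (intro sum.mono_neutral_right) (auto simp: binomial_eq_0)
  also have "\<dots> = S ^ (r + 1 - Suc N) * G * (\<Sum>k\<le>N. of_nat (N choose k) * D ^ k * G ^ (N - k))"
    by (simp add: sum_distrib_left Suc_diff_le mult_ac)
  also have "(\<Sum>k\<le>N. of_nat (N choose k) * D ^ k * G ^ (N - k)) = S ^ N"
    using binomial_ring[of D G N] assms by (simp add: add.commute)
  also have "S ^ (r + 1 - Suc N) * G * S ^ N = S ^ r * G"
    using N by (simp add: mult_ac flip: power_add)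
  finally show ?thesis using N by simp
qed

text \<open>Indexing by the exponent of the first variable fits the pairs \<open>(a, i - a)\<close>
  of the triangular reindexing below.\<close>

lemma b_fun_eq:
  "b_fun n i z1 z2 = (\<Sum>j\<le>i. of_real (coeff_c n i (i - j)) *
     (sigma_fun z1 * delta_fun z1) ^ j * (sigma_fun z2 * delta_fun z2) ^ (i - j))"
  unfolding b_fun_def
  by (rule sum.reindex_bij_witness[of _ "\<lambda>j. i - j" "\<lambda>j. i - j"]) auto

text \<open>The last two binomials of \<open>coeff_c\<close> depend only on \<open>a - k\<close>,
  \<open>b - k\<close> and \<open>a - b\<close>. Summing along \<open>(a + k, b + k)\<close>
  therefore pulls them out of the sum over \<open>k\<close>, and \<open>binomial_collapse\<close>
  evaluates the rest.\<close>

lemma a_family_eq_diag_kernel: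
  "a_family (Suc m) m z1 z2 =
     4 * diag_kernel m (delta_fun z1) (sigma_fun z1) (delta_fun z2) (sigma_fun z2)"
proof -
  define p x q y where "p = delta_fun z1" and "x = sigma_fun z1"
    and "q = delta_fun z2" and "y = sigma_fun z2"
  define S G where "S = x * y" and "G = x * y - p * q"
  define M where "M i = (m + 1 - i) div 2" for i
  define h :: "nat \<Rightarrow> nat \<Rightarrow> complex" where
    "h a b = of_nat ((m + a - b) choose a) * of_nat ((m + b - a) choose b)" for a b
  define t where "t a b k = of_nat ((M (a + b) + k - 1) choose k) *
      (of_nat ((m + a - b) choose (a - k)) * of_nat ((m + b - a) choose (b - k))) *
      (S ^ (m + 1 - (a + b) - M (a + b)) * G ^ M (a + b) * ((x * p) ^ a * (y * q) ^ b))" for a b k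
  have "a_family (Suc m) m z1 z2 = (\<Sum>i\<le>m. \<Sum>a\<le>i.
     4 * (\<Sum>k\<le>min a (i - a). t a (i - a) k))"
    unfolding a_family_def atLeast0AtMost
  proof (rule sum.cong[OF refl])
    fix i assume "i \<in> {..m}"
    then have i: "i \<le> m" by simp
    have ceil: "(Suc m - i + 1) div 2 = m + 1 - i - M i"
      using i unfolding M_def by linarith
    have "a_tilde (Suc m - i) z1 z2 * b_fun (Suc m) i z1 z2 =
      (\<Sum>a\<le>i. 4 * (of_real (coeff_c (Suc m) i (i - a)) *
         (S ^ (m + 1 - i - M i) * G ^ M i * ((x * p) ^ a * (y * q) ^ (i - a)))))"
      unfolding b_fun_eq a_tilde_eq S_fun_def G_fun_def ceil
      unfolding p_def[symmetric] q_def[symmetric] x_def[symmetric] y_def[symmetric]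
      by (simp add: S_def G_def M_def sum_distrib_left mult_ac)
    also have "\<dots> = (\<Sum>a\<le>i. 4 * (\<Sum>k\<le>min a (i - a). t a (i - a) k))"
    proof (rule sum.cong[OF refl])
      fix a assume "a \<in> {..i}"
      then have ai: "a + (i - a) = i" by simp
      have c: "coeff_c (Suc m) i (i - a) = (\<Sum>k\<le>min a (i - a). of_nat ((M i + k - 1) choose k) *
        (of_nat ((m + a - (i - a)) choose (a - k)) * of_nat ((m + (i - a) - a) choose (i - a - k))))"
        using coeff_c_eq[of a "i - a" m] i unfolding ai M_def by simp
      show "4 * (of_real (coeff_c (Suc m) i (i - a)) *
         (S ^ (m + 1 - i - M i) * G ^ M i * ((x * p) ^ a * (y * q) ^ (i - a)))) =
         4 * (\<Sum>k\<le>min a (i - a). t a (i - a) k)"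
        unfolding c t_def ai by (simp add: sum_distrib_right)
    qed
    finally show "a_tilde (Suc m - i) z1 z2 * b_fun (Suc m) i z1 z2 =
      (\<Sum>a\<le>i. 4 * (\<Sum>k\<le>min a (i - a). t a (i - a) k))" .
  qed
  also have "\<dots> = (\<Sum>(a, b) | a + b \<le> m. 4 * (\<Sum>k\<le>min a b. t a b k))"
    by (rule sum.triangle_reindex_eq[symmetric])
  also have "\<dots> = 4 * (\<Sum>(a, b) | a + b \<le> m. \<Sum>k\<le>min a b. t a b k)"
    by (simp add: sum_distrib_left case_prod_unfold)
  also have "(\<Sum>(a, b) | a + b \<le> m. \<Sum>k\<le>min a b. t a b k) =
      (\<Sum>((a, b), k) \<in> (SIGMA ab : {(a, b). a + b \<le> m}. {..min (fst ab) (snd ab)}). t a b k)"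
  proof -
    have "finite {(a, b). a + b \<le> m}"
      by (rule finite_subset[of _ "{..m} \<times> {..m}"]) auto
    then show ?thesis by (simp add: sum.Sigma case_prod_unfold)
  qed
  \<comment> \<open>After the diagonal shift by \<open>k\<close>, the condition on the total degree
    reads \<open>a + b + 2 * k \<le> m\<close>.\<close>
  also have "\<dots> = (\<Sum>((a, b), k) \<in> (SIGMA ab : {(a, b). a + b \<le> m}. {..(m - fst ab - snd ab) div 2}).
       t (a + k) (b + k) k)"
    by (rule sum.reindex_bij_witness[of _ "\<lambda>((a, b), k). ((a + k, b + k), k)" "\<lambda>((a, b), k). ((a - k, b - k), k)"])
       auto
  also have "\<dots> = (\<Sum>(a, b) | a + b \<le> m. \<Sum>k\<le>(m - a - b) div 2. t (a + k) (b + k) k)"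
  proof -
    have "finite {(a, b). a + b \<le> m}"
      by (rule finite_subset[of _ "{..m} \<times> {..m}"]) auto
    then show ?thesis by (simp add: sum.Sigma case_prod_unfold)
  qed
  also have "\<dots> = diag_kernel m p x q y"
    unfolding diag_kernel_def
  proof (rule sum.cong[OF refl], clarify)
    fix a b :: nat assume ab: "a + b \<le> m"
    define r where "r = m - a - b"
    have xr: "x ^ (m - b) = x ^ a * x ^ r" "y ^ (m - a) = y ^ b * y ^ r"
      using ab by (simp_all add: r_def flip: power_add)
    have t: "t (a + k) (b + k) k = h a b * (x * p) ^ a * (y * q) ^ b *
       (of_nat (((r + 1) div 2 - 1) choose k) * (p * q) ^ k *
            S ^ (r + 1 - (r + 1) div 2) * G ^ ((r + 1) div 2 - k))" if k: "k \<le> r div 2" for k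
    proof -
      have e: "M (a + k + (b + k)) = (r + 1) div 2 - k" "(r + 1) div 2 - k + k = (r + 1) div 2"
        "m + 1 - (a + k + (b + k)) - ((r + 1) div 2 - k) + k = r + 1 - (r + 1) div 2"
        "m + (a + k) - (b + k) = m + a - b" "m + (b + k) - (a + k) = m + b - a"
        using k ab unfolding M_def r_def by linarith+
      \<comment> \<open>The shift contributes the factor \<open>(x * p * y * q) ^ k\<close>: it
        restores \<open>k\<close> powers of \<open>S\<close> and leaves \<open>(p * q) ^ k\<close>
        for the binomial theorem.\<close>
      have "S ^ (m + 1 - (a + k + (b + k)) - ((r + 1) div 2 - k)) * ((x * p) ^ (a + k) * (y * q) ^ (b + k))
         = S ^ (m + 1 - (a + k + (b + k)) - ((r + 1) div 2 - k) + k) * (p * q) ^ k * ((x * p) ^ a * (y * q) ^ b)"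
        unfolding power_add by (simp add: S_def power_mult_distrib mult_ac)
      then show ?thesis
        unfolding t_def e h_def by (simp add: mult_ac)
    qed
    have "(\<Sum>k\<le>r div 2. t (a + k) (b + k) k) = h a b * (x * p) ^ a * (y * q) ^ b *
       (\<Sum>k\<le>r div 2. of_nat (((r + 1) div 2 - 1) choose k) * (p * q) ^ k *
            S ^ (r + 1 - (r + 1) div 2) * G ^ ((r + 1) div 2 - k))"
      unfolding sum_distrib_left by (rule sum.cong) (auto simp: t)
    also have "(\<Sum>k\<le>r div 2. of_nat (((r + 1) div 2 - 1) choose k) * (p * q) ^ k *
            S ^ (r + 1 - (r + 1) div 2) * G ^ ((r + 1) div 2 - k)) =
         S ^ r * (if a + b = m then S else G)"
    proof (cases "r = 0")
      \<comment> \<open>Only \<open>k = 0\<close> occurs and no factor \<open>G\<close> is left.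
        This is the source of the weight \<open>x * y\<close> on the edge
        \<open>a + b = m\<close>.\<close>
      case True
      then show ?thesis using ab by (simp add: r_def)
    next
      case False
      then show ?thesis
        using binomial_collapse[of G "p * q" S r] ab by (simp add: r_def S_def G_def)
    qed
    finally show "(\<Sum>k\<le>(m - a - b) div 2. t (a + k) (b + k) k) =
       of_nat ((m + a - b) choose a) * of_nat ((m + b - a) choose b) *
        (p ^ a * x ^ (m - b)) * (q ^ b * y ^ (m - a)) *
        (if a + b = m then x * y else x * y - p * q)"
      unfolding r_def[symmetric] h_def xr S_def G_def by (simp add: power_mult_distrib mult_ac)
  qed
  finally show ?thesis by (simp add: p_def q_def x_def y_def)
qed

section \<open>Sign changes and interpolation\<close>

lemma sigma_fun_minus: "sigma_fun (- z) = delta_fun z"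
  by (simp add: sigma_fun_def delta_fun_def)

lemma delta_fun_minus: "delta_fun (- z) = sigma_fun z"
  by (simp add: sigma_fun_def delta_fun_def)

lemma delta_plus_sigma: "z \<noteq> 0 \<Longrightarrow> delta_fun z + sigma_fun z = 1"
  by (simp add: sigma_fun_def delta_fun_def field_simps power2_eq_square)

lemma interpolatory_a_family: "interpolatory (a_family (Suc m) m)"
  unfolding interpolatory_def
proof (intro allI impI)
  fix z1 z2 :: complex assume z: "z1 \<noteq> 0" "z2 \<noteq> 0"
  have "diag_kernel m (delta_fun z1) (sigma_fun z1) (delta_fun z2) (sigma_fun z2) +
     diag_kernel m (sigma_fun z1) (delta_fun z1) (delta_fun z2) (sigma_fun z2) +
     (diag_kernel m (delta_fun z1) (sigma_fun z1) (sigma_fun z2) (delta_fun z2) +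
     diag_kernel m (sigma_fun z1) (delta_fun z1) (sigma_fun z2) (delta_fun z2)) = 1" (is "?s = 1")
    using z by (intro diag_kernel_partition_of_unity delta_plus_sigma)
  moreover have "a_family (Suc m) m z1 z2 + a_family (Suc m) m z1 (- z2) +
      a_family (Suc m) m (- z1) z2 + a_family (Suc m) m (- z1) (- z2) = 4 * ?s"
    unfolding a_family_eq_diag_kernel sigma_fun_minus delta_fun_minus by (simp only: algebra_simps)
  ultimately show "a_family (Suc m) m z1 z2 + a_family (Suc m) m z1 (- z2) +
      a_family (Suc m) m (- z1) z2 + a_family (Suc m) m (- z1) (- z2) = 4" by simp
qed

section \<open>Order of vanishing at a point\<close>

text \<open>
  Only finite sums of separated products occur, which spares the theory of analytic functions of two
  variables; the last rule discards the junk values at $0$.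
\<close>

inductive vanishing :: "complex \<Rightarrow> complex \<Rightarrow> nat \<Rightarrow> (complex \<Rightarrow> complex \<Rightarrow> complex) \<Rightarrow> bool"
  for c d where
  separated: "\<phi> holomorphic_on - {0} \<Longrightarrow> \<psi> holomorphic_on - {0} \<Longrightarrow> N \<le> a + b \<Longrightarrow>
    vanishing c d N (\<lambda>z w. ((z - c) ^ a * \<phi> z) * ((w - d) ^ b * \<psi> w))"
| add: "vanishing c d N f \<Longrightarrow> vanishing c d N g \<Longrightarrow> vanishing c d N (\<lambda>z w. f z w + g z w)"
| cong: "vanishing c d N f \<Longrightarrow> (\<And>z w. z \<noteq> 0 \<Longrightarrow> w \<noteq> 0 \<Longrightarrow> f z w = g z w) \<Longrightarrow> vanishing c d N g"

text \<open>Nested induction over both derivations; for two separated products the exponents add up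
  and the holomorphic factors multiply.\<close>

lemma vanishing_mult:
  assumes "vanishing c d N f" "vanishing c d M g"
  shows "vanishing c d (N + M) (\<lambda>z w. f z w * g z w)"
  using assms
proof (induction rule: vanishing.induct)
  case (separated \<phi> \<psi> N a b)
  from separated(4) show ?case
  proof (induction rule: vanishing.induct)
    case (separated \<phi>' \<psi>' M a' b')
    have "vanishing c d (N + M) (\<lambda>z w. ((z - c) ^ (a + a') * (\<phi> z * \<phi>' z)) * ((w - d) ^ (b + b') * (\<psi> w * \<psi>' w)))"
      using \<open>\<phi> holomorphic_on _\<close> \<open>\<psi> holomorphic_on _\<close> \<open>N \<le> _\<close> separated
      by (intro vanishing.separated holomorphic_intros) auto
    then show ?case by (rule vanishing.cong) (simp add: power_add mult_ac)
  next
    case (add M f g)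
    show ?case by (rule vanishing.cong[OF vanishing.add[OF add.IH]]) (simp add: distrib_left)
  next
    case (cong M f g)
    show ?case by (rule vanishing.cong[OF cong.IH]) (simp add: cong.hyps)
  qed
next
  case (add N f1 f2)
  show ?case
    by (rule vanishing.cong[OF vanishing.add[OF add.IH(1)[OF add.prems] add.IH(2)[OF add.prems]]])
       (simp add: distrib_right)
next
  case (cong N f1 f2)
  show ?case by (rule vanishing.cong[OF cong.IH[OF cong.prems]]) (simp add: cong.hyps)
qed

lemma vanishing_mono: "vanishing c d N f \<Longrightarrow> M \<le> N \<Longrightarrow> vanishing c d M f"
proof (induction rule: vanishing.induct)
  case (separated \<phi> \<psi> N a b)
  then show ?case by (intro vanishing.separated) auto
next
  case (add N f g)
  then show ?case by (intro vanishing.add)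
next
  case (cong N f g)
  show ?case by (rule vanishing.cong[OF cong.IH[OF cong.prems]]) (simp add: cong.hyps)
qed

lemma vanishing_const: "vanishing c d 0 (\<lambda>z w. k)"
  using vanishing.separated[of "\<lambda>_. k" "\<lambda>_. 1" 0 0 0 c d] by simp

lemma vanishing_zero: "vanishing c d N (\<lambda>z w. 0)"
  using vanishing.separated[of "\<lambda>_. 0" "\<lambda>_. 0" N N 0 c d] by simp

lemma vanishing_cmult: "vanishing c d N f \<Longrightarrow> vanishing c d N (\<lambda>z w. k * f z w)"
  using vanishing_mult[OF vanishing_const, of c d N f k] by simp

lemma vanishing_diff:
  "vanishing c d N f \<Longrightarrow> vanishing c d N g \<Longrightarrow> vanishing c d N (\<lambda>z w. f z w - g z w)"
  using vanishing.add[OF _ vanishing_cmult[of c d N g "-1"]] by simp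

lemma vanishing_power: "vanishing c d N f \<Longrightarrow> vanishing c d (N * k) (\<lambda>z w. f z w ^ k)"
  by (induction k) (auto simp: vanishing_const intro: vanishing_mult)

lemma vanishing_sum:
  "(\<And>i. i \<in> I \<Longrightarrow> vanishing c d N (f i)) \<Longrightarrow> vanishing c d N (\<lambda>z w. \<Sum>i\<in>I. f i z w)"
  by (induction I rule: infinite_finite_induct) (auto intro: vanishing_zero vanishing.add)

text \<open>Used to carry vanishing at the corners over to \<open>(1, 1)\<close>. The sign
  \<open>(- 1) ^ a\<close> is absorbed into the holomorphic factor.\<close>

lemma vanishing_uminus_fst:
  "vanishing c d N f \<Longrightarrow> vanishing (- c) d N (\<lambda>z w. f (- z) w)"
proof (induction rule: vanishing.induct)
  case (separated \<phi> \<psi> N a b)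
  have "(\<lambda>z. (- 1) ^ a * (\<phi> \<circ> uminus) z) holomorphic_on - {0}"
    by (intro holomorphic_intros holomorphic_on_compose holomorphic_on_subset[OF separated(1)]) auto
  then have "vanishing (- c) d N (\<lambda>z w. ((z - - c) ^ a * ((- 1) ^ a * (\<phi> \<circ> uminus) z)) * ((w - d) ^ b * \<psi> w))"
    using separated by (intro vanishing.separated)
  then show ?case
  proof (rule vanishing.cong)
    fix z w :: complex
    have "(- z - c) ^ a = (z - - c) ^ a * (- 1) ^ a"
      by (simp flip: power_mult_distrib)
    then show "((z - - c) ^ a * ((- 1) ^ a * (\<phi> \<circ> uminus) z)) * ((w - d) ^ b * \<psi> w) =
      ((- z - c) ^ a * \<phi> (- z)) * ((w - d) ^ b * \<psi> w)" by simp
  qed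
next
  case (add N f g)
  then show ?case by (intro vanishing.add)
next
  case (cong N f g)
  show ?case by (rule vanishing.cong[OF cong.IH]) (simp add: cong.hyps)
qed

lemma vanishing_swap: "vanishing c d N f \<Longrightarrow> vanishing d c N (\<lambda>z w. f w z)"
proof (induction rule: vanishing.induct)
  case (separated \<phi> \<psi> N a b)
  have "vanishing d c N (\<lambda>z w. ((z - d) ^ b * \<psi> z) * ((w - c) ^ a * \<phi> w))"
    using separated by (intro vanishing.separated) auto
  then show ?case by (simp add: mult_ac)
next
  case (add N f g)
  then show ?case by (intro vanishing.add)
next
  case (cong N f g)
  show ?case by (rule vanishing.cong[OF cong.IH]) (simp add: cong.hyps)
qed

lemma vanishing_uminus_snd:
  "vanishing c d N f \<Longrightarrow> vanishing c (- d) N (\<lambda>z w. f z (- w))"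
  using vanishing_swap[OF vanishing_uminus_fst[OF vanishing_swap]] .

section \<open>Mixed derivatives of vanishing functions\<close>

lemma higher_deriv_zero_of_power_factor:
  assumes "\<phi> holomorphic_on - {0}" "c \<noteq> 0" "k < a"
  shows "(deriv ^^ k) (\<lambda>z. (z - c) ^ a * \<phi> z) c = (0::complex)"
proof -
  have "(deriv ^^ k) (\<lambda>z. (z - c) ^ a * \<phi> z) c =
     (\<Sum>j = 0..k. of_nat (k choose j) * (deriv ^^ j) (\<lambda>z. (z - c) ^ a) c * (deriv ^^ (k - j)) \<phi> c)"
    using assms by (intro higher_deriv_mult[of _ "- {0}"] holomorphic_intros) auto
  also have "\<dots> = 0"
    using assms(3) by (intro sum.neutral) (auto simp: higher_deriv_power)
  finally show ?thesis .
qed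

lemma vanishing_regular:
  assumes "vanishing c d N f" "z \<noteq> 0"
  shows "f z holomorphic_on - {0}"
  using assms
proof (induction rule: vanishing.induct)
  case (cong N f g)
  then show ?case by (intro holomorphic_transform[OF cong.IH]) auto
qed (auto intro!: holomorphic_intros)

text \<open>\<open>partial_D\<close> differentiates in the second variable first, so additivity of
  the outer derivative needs the inner one to be holomorphic in the first variable.\<close>

lemma vanishing_higher_deriv_regular:
  assumes "vanishing c d N f" "w \<noteq> 0"
  shows "(\<lambda>z. (deriv ^^ k) (f z) w) holomorphic_on - {0}"
  using assms(1)
proof (induction rule: vanishing.induct)
  case (separated \<phi> \<psi> N a b)
  have "(deriv ^^ k) (\<lambda>w. ((z - c) ^ a * \<phi> z) * ((w - d) ^ b * \<psi> w)) w =
        ((z - c) ^ a * \<phi> z) * (deriv ^^ k) (\<lambda>w. (w - d) ^ b * \<psi> w) w" for z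
    using separated assms(2) by (intro higher_deriv_cmult[of _ "- {0}"] holomorphic_intros) auto
  then show ?case
    using separated by (auto intro!: holomorphic_intros)
next
  case (add N f g)
  have "(deriv ^^ k) (\<lambda>w. f z w + g z w) w = (deriv ^^ k) (f z) w + (deriv ^^ k) (g z) w" if "z \<noteq> 0" for z
    using that assms(2) add.hyps by (intro higher_deriv_add[of _ "- {0}"] vanishing_regular) auto
  then show ?case
    by (intro holomorphic_transform[OF holomorphic_on_add[OF add.IH]]) auto
next
  case (cong N f g)
  have "(deriv ^^ k) (g z) w = (deriv ^^ k) (f z) w" if "z \<noteq> 0" for z
  proof (intro higher_deriv_cong_ev refl)
    show "\<forall>\<^sub>F w' in nhds w. g z w' = f z w'"
      by (rule eventually_mono[OF t1_space_nhds[OF assms(2)]]) (simp add: cong.hyps that)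
  qed
  then show ?case
    by (intro holomorphic_transform[OF cong.IH]) auto
qed

text \<open>The orders \<open>N\<close> and \<open>M\<close> are independent, so that a constant, of
  order 0, can later be split off.\<close>

lemma partial_D_add:
  assumes f: "vanishing c d N f" and g: "vanishing c d M g" and c: "c \<noteq> 0" and d: "d \<noteq> 0"
  shows "partial_D k1 k2 (\<lambda>z w. f z w + g z w) c d = partial_D k1 k2 f c d + partial_D k1 k2 g c d"
proof -
  have ev: "\<forall>\<^sub>F z in nhds c. z \<noteq> 0"
    using t1_space_nhds[OF c] by simp
  have "partial_D k1 k2 (\<lambda>z w. f z w + g z w) c d =
     (deriv ^^ k1) (\<lambda>z. (deriv ^^ k2) (f z) d + (deriv ^^ k2) (g z) d) c"
    unfolding partial_D_def
  proof (intro higher_deriv_cong_ev refl eventually_mono[OF ev])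
    fix z :: complex assume z: "z \<noteq> 0"
    show "(deriv ^^ k2) (\<lambda>w. f z w + g z w) d = (deriv ^^ k2) (f z) d + (deriv ^^ k2) (g z) d"
      by (rule higher_deriv_add[OF vanishing_regular[OF f z] vanishing_regular[OF g z]]) (use d in auto)
  qed
  also have "\<dots> = (deriv ^^ k1) (\<lambda>z. (deriv ^^ k2) (f z) d) c + (deriv ^^ k1) (\<lambda>z. (deriv ^^ k2) (g z) d) c"
    by (rule higher_deriv_add[OF vanishing_higher_deriv_regular[OF f d] vanishing_higher_deriv_regular[OF g d]])
       (use c in auto)
  finally show ?thesis by (simp add: partial_D_def)
qed

lemma partial_D_vanishing:
  assumes "vanishing c d N f" "c \<noteq> 0" "d \<noteq> 0" "k1 + k2 < N"
  shows "partial_D k1 k2 f c d = 0"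
  using assms
proof (induction rule: vanishing.induct)
  case (separated \<phi> \<psi> N a b)
  have 1: "(deriv ^^ k2) (\<lambda>w. ((z - c) ^ a * \<phi> z) * ((w - d) ^ b * \<psi> w)) d =
        (deriv ^^ k2) (\<lambda>w. (w - d) ^ b * \<psi> w) d * ((z - c) ^ a * \<phi> z)" for z
    using separated by (subst higher_deriv_cmult[of _ "- {0}"]) (auto intro!: holomorphic_intros)
  have "partial_D k1 k2 (\<lambda>z w. ((z - c) ^ a * \<phi> z) * ((w - d) ^ b * \<psi> w)) c d =
     (deriv ^^ k2) (\<lambda>w. (w - d) ^ b * \<psi> w) d * (deriv ^^ k1) (\<lambda>z. (z - c) ^ a * \<phi> z) c"
    unfolding partial_D_def 1
    using separated by (subst higher_deriv_cmult[of _ "- {0}"]) (auto intro!: holomorphic_intros)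
  \<comment> \<open>The derivative of a separated product factors, and
    \<open>k1 + k2 < N \<le> a + b\<close> leaves too few derivatives to remove both zeros.\<close>
  moreover have "k1 < a \<or> k2 < b" using separated by linarith
  ultimately show ?case
    using separated higher_deriv_zero_of_power_factor by auto
next
  case (add N f g)
  then show ?case by (simp add: partial_D_add)
next
  case (cong N f g)
  have ev: "\<forall>\<^sub>F z in nhds c. z \<noteq> 0" "\<forall>\<^sub>F z in nhds d. z \<noteq> 0"
    using t1_space_nhds[OF \<open>c \<noteq> 0\<close>] t1_space_nhds[OF \<open>d \<noteq> 0\<close>] by auto
  have "partial_D k1 k2 g c d = partial_D k1 k2 f c d"
    unfolding partial_D_def
    by (intro higher_deriv_cong_ev refl eventually_mono[OF ev(1)] eventually_mono[OF ev(2)])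
       (simp add: cong.hyps)
  then show ?case using cong by simp
qed

lemma vanishing_value:
  assumes "vanishing c d N f" "c \<noteq> 0" "d \<noteq> 0" "N > 0"
  shows "f c d = 0"
  using partial_D_vanishing[of c d N f 0 0] assms by (simp add: partial_D_def)

section \<open>Generation and reproduction\<close>

lemma holomorphic_sigma: "sigma_fun holomorphic_on - {0}"
  unfolding sigma_fun_def by (intro holomorphic_intros) auto

lemma holomorphic_delta: "delta_fun holomorphic_on - {0}"
  unfolding delta_fun_def by (intro holomorphic_intros) auto

lemma holomorphic_quarter_inverse: "(\<lambda>z. k / (4 * z)) holomorphic_on - {0}"
  by (intro holomorphic_intros) auto

lemma vanishing_sigma_0: "vanishing c d 0 (\<lambda>z w. sigma_fun z)"
  using vanishing.separated[OF holomorphic_sigma, of "\<lambda>_. 1" 0 0 0 c d] by simp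

lemma vanishing_delta_0: "vanishing c d 0 (\<lambda>z w. delta_fun z)"
  using vanishing.separated[OF holomorphic_delta, of "\<lambda>_. 1" 0 0 0 c d] by simp

lemma vanishing_sigma_2: "vanishing (- 1) d 2 (\<lambda>z w. sigma_fun z)"
  using vanishing.separated[OF holomorphic_quarter_inverse[of 1], of "\<lambda>_. 1" 2 2 0 "-1" d]
  by (simp add: sigma_fun_def add.commute)

lemma vanishing_delta_2: "vanishing 1 d 2 (\<lambda>z w. delta_fun z)"
  using vanishing_uminus_fst[OF vanishing_sigma_2, of d] by (simp add: sigma_fun_minus)

text \<open>The double zero comes from \<open>delta_fun\<close> at 1 and from
  \<open>sigma_fun\<close> at -1.\<close>

lemma vanishing_sigma_mult_delta:
  assumes "c = 1 \<or> c = -1"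
  shows "vanishing c d 2 (\<lambda>z w. sigma_fun z * delta_fun z)"
  using assms vanishing_mult[OF vanishing_sigma_0 vanishing_delta_2, of d]
    vanishing_mult[OF vanishing_sigma_2 vanishing_delta_0, of d] by (auto simp: numeral_2_eq_2)

text \<open>Each summand has order \<open>2 * (i - j) + 2 * j\<close>, uniformly in
  \<open>j\<close>.\<close>

lemma vanishing_b_fun:
  assumes "c = 1 \<or> c = -1" "d = 1 \<or> d = -1"
  shows "vanishing c d (2 * i) (b_fun n i)"
proof -
  have "vanishing c d (2 * i) (\<lambda>z w. of_real (coeff_c n i j) *
        (sigma_fun z * delta_fun z) ^ (i - j) * (sigma_fun w * delta_fun w) ^ j)" if "j \<in> {0..i}" for j
  proof (rule vanishing_mono)
    show "vanishing c d (0 + 2 * (i - j) + 2 * j) (\<lambda>z w. of_real (coeff_c n i j) *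
        (sigma_fun z * delta_fun z) ^ (i - j) * (sigma_fun w * delta_fun w) ^ j)"
      by (intro vanishing_mult vanishing_power vanishing_const
        vanishing_sigma_mult_delta vanishing_swap[OF vanishing_sigma_mult_delta] assms)
  qed (use that in auto)
  then have "vanishing c d (2 * i) (\<lambda>z w. \<Sum>j = 0..i. of_real (coeff_c n i j) *
        (sigma_fun z * delta_fun z) ^ (i - j) * (sigma_fun w * delta_fun w) ^ j)"
    by (rule vanishing_sum)
  then show ?thesis by (simp add: b_fun_def[abs_def])
qed

lemma vanishing_a_tilde:
  assumes S: "vanishing c d s S_fun" and G: "vanishing c d g G_fun"
    and le: "2 * m \<le> s * ((m + 1) div 2) + g * (m div 2)"
  shows "vanishing c d (2 * m) (a_tilde m)"
proof -
  have "vanishing c d (0 + s * ((m + 1) div 2) + g * (m div 2))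
     (\<lambda>z w. 4 * S_fun z w ^ ((m + 1) div 2) * G_fun z w ^ (m div 2))"
    by (intro vanishing_mult vanishing_power vanishing_const S G)
  then show ?thesis
    using le by (auto simp: a_tilde_eq[abs_def] intro: vanishing_mono)
qed

text \<open>At \<open>(-1, 1)\<close> and \<open>(1, -1)\<close> both \<open>S_fun\<close> and
  \<open>G_fun\<close> have order 2, which adds up to \<open>2 * m\<close>. At
  \<open>(-1, -1)\<close> only \<open>S_fun\<close> vanishes, to order 4, and rounding its exponent
  up still yields at least \<open>2 * m\<close>.\<close>

lemma vanishing_a_tilde_corner:
  assumes "(c, d) \<in> {(-1, 1), (1, -1), (-1, -1)}"
  shows "vanishing c d (2 * m) (a_tilde m)"
proof -
  have mp: "vanishing (-1) 1 2 (\<lambda>z w. sigma_fun z * sigma_fun w)"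
    "vanishing (-1) 1 2 (\<lambda>z w. delta_fun z * delta_fun w)"
    using vanishing_mult[OF vanishing_sigma_2 vanishing_swap[OF vanishing_sigma_0], of 1]
      vanishing_mult[OF vanishing_delta_0 vanishing_swap[OF vanishing_delta_2], of "-1"]
    by (simp_all add: numeral_2_eq_2)
  then have S: "vanishing (-1) 1 2 S_fun" and G: "vanishing (-1) 1 2 G_fun"
    using vanishing_diff[of "-1" 1 2] by (simp_all add: S_fun_def[abs_def] G_fun_def[abs_def])
  have sym: "(\<lambda>z w. S_fun w z) = S_fun" "(\<lambda>z w. G_fun w z) = G_fun"
    by (simp_all add: S_fun_def G_fun_def fun_eq_iff mult.commute)
  have "vanishing (-1) (-1) (2 + 2) (\<lambda>z w. sigma_fun z * sigma_fun w)"
    by (intro vanishing_mult vanishing_sigma_2 vanishing_swap[OF vanishing_sigma_2])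
  then have SS: "vanishing (-1) (-1) 4 S_fun" by (simp add: S_fun_def[abs_def])
  have "vanishing (-1) (-1) (0 + 0) (\<lambda>z w. delta_fun z * delta_fun w)"
    by (intro vanishing_mult vanishing_delta_0 vanishing_swap[OF vanishing_delta_0])
  then have GG: "vanishing (-1) (-1) 0 G_fun"
    using vanishing_diff[OF vanishing_mono[OF SS, of 0]] by (simp add: S_fun_def G_fun_def[abs_def])
  have le: "2 * m \<le> 2 * ((m + 1) div 2) + 2 * (m div 2)" by presburger
  have le': "2 * m \<le> 4 * ((m + 1) div 2) + 0 * (m div 2)" by linarith
  show ?thesis
    using assms vanishing_a_tilde[OF S G le] vanishing_a_tilde[OF SS GG le']
      vanishing_a_tilde[OF vanishing_swap[OF S, unfolded sym] vanishing_swap[OF G, unfolded sym] le]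
    by auto
qed

lemma vanishing_a_family:
  assumes "(c, d) \<in> {(-1, 1), (1, -1), (-1, -1)}" "l < n"
  shows "vanishing c d (2 * n) (a_family n l)"
proof -
  have "vanishing c d (2 * n) (\<lambda>z w. a_tilde (n - i) z w * b_fun n i z w)" if "i \<in> {0..l}" for i
  proof -
    have "vanishing c d (2 * (n - i) + 2 * i) (\<lambda>z w. a_tilde (n - i) z w * b_fun n i z w)"
      using assms(1) by (intro vanishing_mult vanishing_a_tilde_corner vanishing_b_fun) auto
    then show ?thesis using that assms(2) by (simp add: algebra_simps)
  qed
  then show ?thesis unfolding a_family_def[abs_def] by (intro vanishing_sum)
qed

lemma generates_polys_a_family:
  assumes "l < n"
  shows "generates_polys (a_family n l) (2 * n - 1)"
  unfolding generates_polys_def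
proof (clarify, goal_cases)
  case (1 c d k1 k2)
  then show ?case
    using assms by (intro partial_D_vanishing[OF vanishing_a_family]) auto
qed

text \<open>Interpolation expresses the difference as minus the sum of the other three sign changes,
  and these move the corners to \<open>(1, 1)\<close>.\<close>

lemma vanishing_a_family_full_minus_4: "vanishing 1 1 (2 * Suc m) (\<lambda>z w. a_family (Suc m) m z w - 4)"
proof -
  let ?a = "a_family (Suc m) m"
  have "vanishing 1 1 (2 * Suc m) (\<lambda>z w. ?a z (- w))"
    using vanishing_uminus_snd[OF vanishing_a_family[of 1 "-1" m "Suc m"]] by simp
  moreover have "vanishing 1 1 (2 * Suc m) (\<lambda>z w. ?a (- z) w)"
    using vanishing_uminus_fst[OF vanishing_a_family[of "-1" 1 m "Suc m"]] by simp
  moreover have "vanishing 1 1 (2 * Suc m) (\<lambda>z w. ?a (- z) (- w))"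
    using vanishing_uminus_fst[OF vanishing_uminus_snd[OF vanishing_a_family[of "-1" "-1" m "Suc m"]]] by simp
  ultimately have "vanishing 1 1 (2 * Suc m) (\<lambda>z w. (- 1) * (?a z (- w) + ?a (- z) w + ?a (- z) (- w)))"
    by (intro vanishing_cmult vanishing.add)
  then show ?thesis
  proof (rule vanishing.cong)
    fix z w :: complex assume "z \<noteq> 0" "w \<noteq> 0"
    then have "?a z w + ?a z (- w) + ?a (- z) w + ?a (- z) (- w) = 4"
      using interpolatory_a_family by (auto simp: interpolatory_def)
    then show "(- 1) * (?a z (- w) + ?a (- z) w + ?a (- z) (- w)) = ?a z w - 4"
      by (simp add: algebra_simps eq_diff_eq)
  qed
qed

lemma vanishing_a_family_minus_4:
  assumes "l < n"
  shows "vanishing 1 1 (2 * Suc l) (\<lambda>z w. a_family n l z w - 4)"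
proof -
  obtain m where n: "n = Suc m" using assms by (cases n) auto
  \<comment> \<open>At \<open>(1, 1)\<close> the factor \<open>a_tilde\<close> is 4 and contributes
    order 0; the order \<open>2 * i\<close> of \<open>b_fun\<close> suffices, since
    \<open>i > l\<close>.\<close>
  have "vanishing 1 1 (2 * Suc l) (\<lambda>z w. a_tilde (n - i) z w * b_fun n i z w)" if "i \<in> {Suc l..m}" for i
  proof -
    have "vanishing 1 1 (0 + 0) (\<lambda>z w. sigma_fun z * sigma_fun w)" "vanishing 1 1 (0 + 0) (\<lambda>z w. delta_fun z * delta_fun w)"
      by (intro vanishing_mult vanishing_sigma_0 vanishing_delta_0 vanishing_swap[OF vanishing_sigma_0]
        vanishing_swap[OF vanishing_delta_0])+
    then have "vanishing 1 1 (0 + 0 * ((n - i + 1) div 2) + 0 * ((n - i) div 2))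
     (\<lambda>z w. 4 * S_fun z w ^ ((n - i + 1) div 2) * G_fun z w ^ ((n - i) div 2))"
      unfolding S_fun_def G_fun_def
      by (intro vanishing_mult[OF vanishing_mult] vanishing_power vanishing_const vanishing_diff) simp_all
    then have "vanishing 1 1 0 (a_tilde (n - i))"
      by (simp add: a_tilde_eq[abs_def])
    then have "vanishing 1 1 (0 + 2 * i) (\<lambda>z w. a_tilde (n - i) z w * b_fun n i z w)"
      by (intro vanishing_mult vanishing_b_fun) auto
    then show ?thesis by (rule vanishing_mono) (use that in auto)
  qed
  then have tail: "vanishing 1 1 (2 * Suc l) (\<lambda>z w. \<Sum>i = Suc l..m. a_tilde (n - i) z w * b_fun n i z w)"
    by (rule vanishing_sum)
  have full: "vanishing 1 1 (2 * Suc l) (\<lambda>z w. a_family n m z w - 4)"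
    unfolding n by (rule vanishing_mono[OF vanishing_a_family_full_minus_4]) (use assms n in auto)
  have "a_family n m z w = a_family n l z w + (\<Sum>i = Suc l..m. a_tilde (n - i) z w * b_fun n i z w)" for z w
  proof -
    have "{0..m} = {0..l} \<union> {Suc l..m}" using assms n by auto
    then show ?thesis unfolding a_family_def
      by (simp add: sum.union_disjoint)
  qed
  then show ?thesis using vanishing_diff[OF full tail] by simp
qed

lemma reproduces_polys_a_family:
  assumes "l < n"
  shows "reproduces_polys (a_family n l) (2 * l + 1)"
  unfolding reproduces_polys_def
proof (intro conjI exI allI impI)
  show "2 * l + 1 \<le> 2 * n - 1" using assms by simp
  show "generates_polys (a_family n l) (2 * n - 1)"
    using assms by (rule generates_polys_a_family)
  note van = vanishing_a_family_minus_4[OF assms]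
  show "a_family n l 1 1 = 4" using vanishing_value[OF van] by simp
  fix k1 k2 :: nat assume k: "0 < k1 + k2 \<and> k1 + k2 \<le> 2 * l + 1"
  \<comment> \<open>Only the symbol minus 4 vanishes to high order; the constant 4 is killed by any
    derivative of positive order.\<close>
  have "partial_D k1 k2 (\<lambda>z w. (a_family n l z w - 4) + 4) 1 1 =
      partial_D k1 k2 (\<lambda>z w. a_family n l z w - 4) 1 1 + partial_D k1 k2 (\<lambda>z w. 4) 1 1"
    by (rule partial_D_add[OF van vanishing_const]) auto
  also have "partial_D k1 k2 (\<lambda>z w. a_family n l z w - 4) 1 1 = 0"
    using k by (intro partial_D_vanishing[OF van]) auto
  also have "partial_D k1 k2 (\<lambda>z w. 4) 1 1 = 0"
    using k by (auto simp: partial_D_def)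
  finally show "partial_D k1 k2 (a_family n l) 1 1 = 0" by simp
qed

section \<open>Laurent polynomials and symmetry\<close>

lemma laurent_symbol_add:
  assumes "laurent_symbol f" "laurent_symbol g"
  shows "laurent_symbol (\<lambda>z w. f z w + g z w)"
proof -
  obtain c where c: "finite {\<alpha>. c \<alpha> \<noteq> 0}"
    "\<And>z w. z \<noteq> 0 \<Longrightarrow> w \<noteq> 0 \<Longrightarrow> f z w = (\<Sum>\<alpha> | c \<alpha> \<noteq> 0. of_real (c \<alpha>) * z powi fst \<alpha> * w powi snd \<alpha>)"
    using assms(1) unfolding laurent_symbol_def by blast
  obtain c' where c': "finite {\<alpha>. c' \<alpha> \<noteq> 0}"
    "\<And>z w. z \<noteq> 0 \<Longrightarrow> w \<noteq> 0 \<Longrightarrow> g z w = (\<Sum>\<alpha> | c' \<alpha> \<noteq> 0. of_real (c' \<alpha>) * z powi fst \<alpha> * w powi snd \<alpha>)"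
    using assms(2) unfolding laurent_symbol_def by blast
  \<comment> \<open>Coefficients may cancel in the sum, so all three sums are extended to the union
    of the two supports.\<close>
  let ?U = "{\<alpha>. c \<alpha> \<noteq> 0} \<union> {\<alpha>. c' \<alpha> \<noteq> 0}"
  have fin: "finite ?U" using c c' by blast
  have "finite {\<alpha>. c \<alpha> + c' \<alpha> \<noteq> 0}" by (rule finite_subset[OF _ fin]) auto
  moreover have "f z w + g z w =
      (\<Sum>\<alpha> | c \<alpha> + c' \<alpha> \<noteq> 0. of_real (c \<alpha> + c' \<alpha>) * z powi fst \<alpha> * w powi snd \<alpha>)"
    if "z \<noteq> 0" "w \<noteq> 0" for z w
  proof -
    have "f z w = (\<Sum>\<alpha>\<in>?U. of_real (c \<alpha>) * z powi fst \<alpha> * w powi snd \<alpha>)"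
      unfolding c(2)[OF that] using fin by (intro sum.mono_neutral_left) auto
    moreover have "g z w = (\<Sum>\<alpha>\<in>?U. of_real (c' \<alpha>) * z powi fst \<alpha> * w powi snd \<alpha>)"
      unfolding c'(2)[OF that] using fin by (intro sum.mono_neutral_left) auto
    moreover have "(\<Sum>\<alpha> | c \<alpha> + c' \<alpha> \<noteq> 0. of_real (c \<alpha> + c' \<alpha>) * z powi fst \<alpha> * w powi snd \<alpha>)
       = (\<Sum>\<alpha>\<in>?U. of_real (c \<alpha> + c' \<alpha>) * z powi fst \<alpha> * w powi snd \<alpha>)"
      using fin by (intro sum.mono_neutral_left) (auto simp flip: of_real_add)
    ultimately show ?thesis by (simp add: sum.distrib[symmetric] distrib_right)
  qed
  ultimately show ?thesis
    unfolding laurent_symbol_def by (intro exI[of _ "\<lambda>\<alpha>. c \<alpha> + c' \<alpha>"]) blast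
qed

lemma laurent_symbol_cong:
  assumes "laurent_symbol f" "\<And>z w. z \<noteq> 0 \<Longrightarrow> w \<noteq> 0 \<Longrightarrow> f z w = g z w"
  shows "laurent_symbol g"
  using assms unfolding laurent_symbol_def by simp

lemma laurent_symbol_monomial: "laurent_symbol (\<lambda>z w. of_real k * z powi i * w powi j)"
proof (cases "k = 0")
  case True
  then show ?thesis
    unfolding laurent_symbol_def by (intro exI[of _ "\<lambda>_. 0"]) simp
next
  case False
  then have "{\<alpha>. (if \<alpha> = (i, j) then k else 0) \<noteq> 0} = {(i, j)}" by auto
  then show ?thesis
    unfolding laurent_symbol_def by (intro exI[of _ "\<lambda>\<alpha>. if \<alpha> = (i, j) then k else 0"]) simp
qed

lemma laurent_symbol_const: "laurent_symbol (\<lambda>z w. of_real k)"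
  using laurent_symbol_monomial[of k 0 0] by simp

lemma laurent_symbol_sum:
  "(\<And>i. i \<in> I \<Longrightarrow> laurent_symbol (f i)) \<Longrightarrow> laurent_symbol (\<lambda>z w. \<Sum>i\<in>I. f i z w)"
  by (induction I rule: infinite_finite_induct)
     (use laurent_symbol_const[of 0] in \<open>auto intro: laurent_symbol_add\<close>)

text \<open>Expanding into a double sum of monomials avoids an explicit convolution of coefficients;
  closure under sums collects equal exponents.\<close>

lemma laurent_symbol_mult:
  assumes "laurent_symbol f" "laurent_symbol g"
  shows "laurent_symbol (\<lambda>z w. f z w * g z w)"
proof -
  obtain c where c: "finite {\<alpha>. c \<alpha> \<noteq> 0}"
    "\<And>z w. z \<noteq> 0 \<Longrightarrow> w \<noteq> 0 \<Longrightarrow> f z w = (\<Sum>\<alpha> | c \<alpha> \<noteq> 0. of_real (c \<alpha>) * z powi fst \<alpha> * w powi snd \<alpha>)"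
    using assms(1) unfolding laurent_symbol_def by blast
  obtain c' where c': "finite {\<alpha>. c' \<alpha> \<noteq> 0}"
    "\<And>z w. z \<noteq> 0 \<Longrightarrow> w \<noteq> 0 \<Longrightarrow> g z w = (\<Sum>\<alpha> | c' \<alpha> \<noteq> 0. of_real (c' \<alpha>) * z powi fst \<alpha> * w powi snd \<alpha>)"
    using assms(2) unfolding laurent_symbol_def by blast
  have "laurent_symbol (\<lambda>z w. \<Sum>\<alpha> | c \<alpha> \<noteq> 0. \<Sum>\<beta> | c' \<beta> \<noteq> 0.
      of_real (c \<alpha> * c' \<beta>) * z powi (fst \<alpha> + fst \<beta>) * w powi (snd \<alpha> + snd \<beta>))"
    by (intro laurent_symbol_sum laurent_symbol_monomial)
  then show ?thesis
  proof (rule laurent_symbol_cong)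
    fix z w :: complex assume z: "z \<noteq> 0" and w: "w \<noteq> 0"
    show "(\<Sum>\<alpha> | c \<alpha> \<noteq> 0. \<Sum>\<beta> | c' \<beta> \<noteq> 0.
      of_real (c \<alpha> * c' \<beta>) * z powi (fst \<alpha> + fst \<beta>) * w powi (snd \<alpha> + snd \<beta>)) = f z w * g z w"
      unfolding c(2)[OF z w] c'(2)[OF z w] sum_product
      using z w by (simp add: power_int_add mult_ac)
  qed
qed

lemma laurent_symbol_power: "laurent_symbol f \<Longrightarrow> laurent_symbol (\<lambda>z w. f z w ^ k)"
  by (induction k) (use laurent_symbol_const[of 1] in \<open>auto intro: laurent_symbol_mult\<close>)

lemma laurent_symbol_sigma_delta:
  "laurent_symbol (\<lambda>z w. sigma_fun z)" "laurent_symbol (\<lambda>z w. sigma_fun w)"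
  "laurent_symbol (\<lambda>z w. delta_fun z)" "laurent_symbol (\<lambda>z w. delta_fun w)"
proof -
  have e: "of_real (1 / 4) * z powi 1 + of_real (1 / 2) + of_real (1 / 4) * z powi (- 1) = sigma_fun z"
     "of_real (- 1 / 4) * z powi 1 + of_real (1 / 2) + of_real (- 1 / 4) * z powi (- 1) = delta_fun z"
    if "z \<noteq> 0" for z
    using that by (simp_all add: sigma_fun_def delta_fun_def power_int_minus field_simps power2_eq_square)
  have x: "laurent_symbol (\<lambda>z w. of_real k * z powi i)" for k i
    using laurent_symbol_monomial[of k i 0] by simp
  have y: "laurent_symbol (\<lambda>z w. of_real k * w powi i)" for k i
    using laurent_symbol_monomial[of k 0 i] by simp
  show "laurent_symbol (\<lambda>z w. sigma_fun z)" "laurent_symbol (\<lambda>z w. delta_fun z)"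
    by (rule laurent_symbol_cong[OF laurent_symbol_add[OF laurent_symbol_add[OF x laurent_symbol_const] x]], rule e, assumption)+
  show "laurent_symbol (\<lambda>z w. sigma_fun w)" "laurent_symbol (\<lambda>z w. delta_fun w)"
    by (rule laurent_symbol_cong[OF laurent_symbol_add[OF laurent_symbol_add[OF y laurent_symbol_const] y]], rule e, assumption)+
qed

lemma laurent_symbol_a_family: "laurent_symbol (a_family n l)"
proof -
  have S: "laurent_symbol S_fun"
    unfolding S_fun_def[abs_def] by (intro laurent_symbol_mult laurent_symbol_sigma_delta)
  have "laurent_symbol (\<lambda>z w. S_fun z w + of_real (- 1) * (delta_fun z * delta_fun w))"
    by (intro laurent_symbol_add S laurent_symbol_mult laurent_symbol_const laurent_symbol_sigma_delta)
  then have G: "laurent_symbol G_fun"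
    by (rule laurent_symbol_cong) (simp add: S_fun_def G_fun_def)
  have "laurent_symbol (\<lambda>z w. \<Sum>i = 0..l. of_real 4 * S_fun z w ^ nat \<lceil>real (n - i) / 2\<rceil> *
      G_fun z w ^ nat \<lfloor>real (n - i) / 2\<rfloor> * (\<Sum>j = 0..i. of_real (coeff_c n i j) *
        (sigma_fun z * delta_fun z) ^ (i - j) * (sigma_fun w * delta_fun w) ^ j))"
    by (intro laurent_symbol_sum laurent_symbol_mult laurent_symbol_power laurent_symbol_const
        laurent_symbol_sigma_delta S G)
  then show ?thesis
    by (simp add: a_family_def[abs_def] a_tilde_def b_fun_def)
qed

section \<open>Symmetry\<close>

lemma sigma_fun_inverse: "z \<noteq> 0 \<Longrightarrow> sigma_fun (1 / z) = sigma_fun z"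
  by (simp add: sigma_fun_def field_simps power2_eq_square)

lemma delta_fun_inverse: "z \<noteq> 0 \<Longrightarrow> delta_fun (1 / z) = delta_fun z"
  by (simp add: delta_fun_def field_simps power2_eq_square)

text \<open>Replacing \<open>j\<close> by \<open>i - j\<close> exchanges the last two binomial
  coefficients and fixes the first.\<close>

lemma coeff_c_flip: "j \<le> i \<Longrightarrow> coeff_c n i (i - j) = coeff_c n i j"
  unfolding coeff_c_def by (rule sum.cong) (simp_all add: of_nat_diff algebra_simps)

lemma b_fun_swap: "b_fun n i z1 z2 = b_fun n i z2 z1"
  unfolding b_fun_def
  by (rule sum.reindex_bij_witness[of _ "\<lambda>j. i - j" "\<lambda>j. i - j"]) (auto simp: coeff_c_flip mult_ac)

text \<open>Invariance under inversion is inherited from \<open>sigma_fun\<close> and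
  \<open>delta_fun\<close>; exchanging the variables rests on the symmetry of the
  coefficients.\<close>

lemma symbol_symmetric_a_family: "symbol_symmetric (a_family n l)"
proof -
  have "a_family n l z1 z2 = a_family n l z2 z1" for z1 z2
    unfolding a_family_def a_tilde_def b_fun_swap[of n _ z1 z2]
    by (simp add: S_fun_def G_fun_def mult.commute)
  then show ?thesis
    by (simp add: symbol_symmetric_def a_family_def a_tilde_def S_fun_def G_fun_def b_fun_def
        sigma_fun_inverse delta_fun_inverse)
qed

theorem theorem4p4:
  shows "(\<forall>n l :: nat. 1 \<le> n \<and> l < n \<longrightarrow>
            laurent_symbol (a_family n l) \<and>
            symbol_symmetric (a_family n l) \<and>
            generates_polys (a_family n l) (2 * n - 1) \<and>
            reproduces_polys (a_family n l) (2 * l + 1)) \<and>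
         (\<forall>n :: nat. 1 \<le> n \<longrightarrow> interpolatory (a_family n (n - 1)))"
proof (intro conjI allI impI)
  fix n :: nat assume "1 \<le> n"
  then show "interpolatory (a_family n (n - 1))"
    using interpolatory_a_family[of "n - 1"] by simp
qed (simp_all only: laurent_symbol_a_family symbol_symmetric_a_family
      generates_polys_a_family reproduces_polys_a_family)

end
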